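(* Let $\mathcal H$ be a Hilbert space and consider a frame for $\mathcal H$ of the form $\{f_k\}_{k\in\mathbb Z}=\{T^kf_0\}_{k\in\mathbb Z}$ for some linear operator $T:\operatorname{span}\{f_k\}_{k\in\mathbb Z}\to\operatorname{span}\{f_k\}_{k\in\mathbb Z}$, and let $A,B>0$ denote some frame bounds. Let $U$ be the synthesis operator of $\{f_k\}_{k\in\mathbb Z}$ and $N_U$ its kernel. Then the following hold: (i) The operator $T$ is bounded if and only if $N_U$ is invariant under right-shifts; in the affirmative case, $1\le\|T\|\le\sqrt{BA^{-1}}$. (ii) The operator $T^{-1}:\operatorname{span}\{f_k\}_{k\in\mathbb Z}\to\operatorname{span}\{f_k\}_{k\in\mathbb Z}$ is bounded if and only if $N_U$ is invariant under left-shifts; in the affirmative case, $1\le\|T^{-1}\|\le\sqrt{BA^{-1}}$. (iii) Assume that $N_U$ is invariant under right- and left-shifts. Then the operator $T$ has an extension to a bounded bijective operator $\widetilde T:\mathcal H\to\mathcal H$.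
   Context: A sequence $\{f_k\}_{k\in\mathbb Z}$ is a frame for $\mathcal H$ with frame bounds $A,B>0$ if $A\|f\|^2\le\sum_{k\in\mathbb Z}|\langle f,f_k\rangle|^2\le B\|f\|^2$ for all $f\in\mathcal H$. Its synthesis operator is the bounded operator $U:\ell^2(\mathbb Z)\to\mathcal H$, $U\{c_k\}_{k\in\mathbb Z}=\sum_{k\in\mathbb Z}c_kf_k$, and $N_U=\{\{c_k\}_{k\in\mathbb Z}\in\ell^2(\mathbb Z):\sum_{k\in\mathbb Z}c_kf_k=0\}$. The right-shift operator is the unitary operator $\mathcal T:\ell^2(\mathbb Z)\to\ell^2(\mathbb Z)$, $\mathcal T\{c_k\}_{k\in\mathbb Z}=\{c_{k-1}\}_{k\in\mathbb Z}$; a subspace $V\subseteq\ell^2(\mathbb Z)$ is invariant under right-shifts if $\mathcal T(V)\subseteq V$ and invariant under left-shifts if $\mathcal T^{-1}(V)\subseteq V$. Here $\operatorname{span}$ denotes finite linear combinations (not closed). Writing $\{f_k\}_{k\in\mathbb Z}=\{T^kf_0\}_{k\in\mathbb Z}$ for a linear operator $T$ on $\operatorname{span}\{f_k\}_{k\in\mathbb Z}$ means that $T$ is a (not necessarily bounded) bijection of $\operatorname{span}\{f_k\}_{k\in\mathbb Z}$ onto itself and $f_k=T^kf_0$ for all $k\in\mathbb Z$, where $T^k:=(T^{-1})^{-k}$ for $k<0$. *)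

theory Defs
  imports "HOL-Analysis.Analysis"
begin

text \<open>
  A complex Hilbert space is a Banach space whose real scalar multiplication is the restriction
  of a complex one and whose norm comes from a complex inner product, which is linear in the
  first argument.
\<close>

class complex_hilbert_space = banach +
  fixes scaleC :: "complex \<Rightarrow> 'a \<Rightarrow> 'a" (infixr "*\<^sub>C" 75)
    and cinner :: "'a \<Rightarrow> 'a \<Rightarrow> complex"
  assumes scaleC_add_right: "a *\<^sub>C (x + y) = a *\<^sub>C x + a *\<^sub>C y"
    and scaleC_add_left: "(a + b) *\<^sub>C x = a *\<^sub>C x + b *\<^sub>C x"
    and scaleC_scaleC: "a *\<^sub>C b *\<^sub>C x = (a * b) *\<^sub>C x"
    and scaleC_one: "1 *\<^sub>C x = x"
    and scaleR_scaleC: "r *\<^sub>R x = complex_of_real r *\<^sub>C x"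
    and cinner_commute: "cinner x y = cnj (cinner y x)"
    and cinner_add_left: "cinner (x + y) z = cinner x z + cinner y z"
    and cinner_scaleC_left: "cinner (a *\<^sub>C x) y = a * cinner x y"
    and cinner_self_nonneg: "0 \<le> Re (cinner x x)"
    and cinner_self_eq_zero_iff: "cinner x x = 0 \<longleftrightarrow> x = 0"
    and norm_eq_sqrt_cinner: "norm x = sqrt (Re (cinner x x))"

global_interpretation complex_vector:
  vector_space "scaleC :: complex \<Rightarrow> 'a \<Rightarrow> 'a::complex_hilbert_space"
  defines cspan = complex_vector.span
  by standard (simp_all add: scaleC_add_right scaleC_add_left scaleC_scaleC scaleC_one)


definition ell2 :: "(int \<Rightarrow> complex) set" where
  "ell2 = {c. (\<lambda>k. (cmod (c k))\<^sup>2) summable_on UNIV}"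

definition frame_with_bounds :: "(int \<Rightarrow> 'a::complex_hilbert_space) \<Rightarrow> real \<Rightarrow> real \<Rightarrow> bool" where
  "frame_with_bounds f A B \<longleftrightarrow> 0 < A \<and> 0 < B \<and>
     (\<forall>x. (\<lambda>k. (cmod (cinner x (f k)))\<^sup>2) summable_on UNIV \<and>
          A * (norm x)\<^sup>2 \<le> (\<Sum>\<^sub>\<infinity>k. (cmod (cinner x (f k)))\<^sup>2) \<and>
          (\<Sum>\<^sub>\<infinity>k. (cmod (cinner x (f k)))\<^sup>2) \<le> B * (norm x)\<^sup>2)"

definition synthesis :: "(int \<Rightarrow> 'a::complex_hilbert_space) \<Rightarrow> (int \<Rightarrow> complex) \<Rightarrow> 'a" where
  "synthesis f c = (\<Sum>\<^sub>\<infinity>k. c k *\<^sub>C f k)"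

text \<open>
  For a frame the synthesis series converges unconditionally for every square-summable
  sequence. Summability is nevertheless required explicitly below, since the value of
  \<^const>\<open>infsum\<close> is \<open>0\<close> by convention on families that are not summable.
\<close>

definition synthesis_kernel :: "(int \<Rightarrow> 'a::complex_hilbert_space) \<Rightarrow> (int \<Rightarrow> complex) set" where
  "synthesis_kernel f =
     {c \<in> ell2. (\<lambda>k. c k *\<^sub>C f k) summable_on UNIV \<and> synthesis f c = 0}"


definition right_shift :: "(int \<Rightarrow> complex) \<Rightarrow> (int \<Rightarrow> complex)" where
  "right_shift c = (\<lambda>k. c (k - 1))"

definition left_shift :: "(int \<Rightarrow> complex) \<Rightarrow> (int \<Rightarrow> complex)" where
  "left_shift c = (\<lambda>k. c (k + 1))"

lemma left_shift_eq_inv: "left_shift = inv right_shift"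
  by (rule inv_unique_comp [symmetric]) (auto simp: right_shift_def left_shift_def fun_eq_iff)

definition right_shift_invariant :: "(int \<Rightarrow> complex) set \<Rightarrow> bool" where
  "right_shift_invariant V \<longleftrightarrow> right_shift ` V \<subseteq> V"

definition left_shift_invariant :: "(int \<Rightarrow> complex) set \<Rightarrow> bool" where
  "left_shift_invariant V \<longleftrightarrow> left_shift ` V \<subseteq> V"


text \<open>
  An operator on a subspace \<open>S\<close> is given by a function on the whole type, of which only the
  values on \<open>S\<close> matter; its inverse is \<^term>\<open>inv_into S T\<close>.
\<close>

definition clinear_on ::
    "'a::complex_hilbert_space set \<Rightarrow> ('a \<Rightarrow> 'b::complex_hilbert_space) \<Rightarrow> bool" where
  "clinear_on S T \<longleftrightarrow>
     (\<forall>x\<in>S. \<forall>y\<in>S. T (x + y) = T x + T y) \<and> (\<forall>a. \<forall>x\<in>S. T (a *\<^sub>C x) = a *\<^sub>C T x)"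

definition bounded_operator_on ::
    "'a::real_normed_vector set \<Rightarrow> ('a \<Rightarrow> 'b::real_normed_vector) \<Rightarrow> bool" where
  "bounded_operator_on S T \<longleftrightarrow> (\<exists>K. \<forall>x\<in>S. norm (T x) \<le> K * norm x)"

text \<open>
  As for \<^const>\<open>onorm\<close>, the point \<open>x = 0\<close> contributes the quotient \<open>0 / 0 = 0\<close>.
  The supremum is meaningful only for operators that are bounded on \<open>S\<close>.
\<close>

definition onorm_on ::
    "'a::real_normed_vector set \<Rightarrow> ('a \<Rightarrow> 'b::real_normed_vector) \<Rightarrow> real" where
  "onorm_on S T = (SUP x\<in>S. norm (T x) / norm x)"

definition int_funpow_on :: "'a set \<Rightarrow> ('a \<Rightarrow> 'a) \<Rightarrow> int \<Rightarrow> 'a \<Rightarrow> 'a" where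
  "int_funpow_on S T k =
     (if 0 \<le> k then T ^^ nat k else inv_into S T ^^ nat (- k))"

definition represents :: "('a::complex_hilbert_space \<Rightarrow> 'a) \<Rightarrow> (int \<Rightarrow> 'a) \<Rightarrow> bool" where
  "represents T f \<longleftrightarrow>
     clinear_on (cspan (range f)) T \<and>
     bij_betw T (cspan (range f)) (cspan (range f)) \<and>
     (\<forall>k. f k = int_funpow_on (cspan (range f)) T k (f 0))"

end

theory Submission
  imports Defs
begin

text \<open>
  The synthesis operator \<open>U\<close> is onto, and every \<open>x\<close> equals \<open>U c\<close> for some \<open>c\<close> with
  \<open>A \<parallel>c\<parallel>\<^sup>2 \<le> \<parallel>x\<parallel>\<^sup>2\<close>, namely the frame coefficients of the preimage of \<open>x\<close> under the frame operator.
  On the span of the frame, \<open>T (U c) = U (shift c)\<close>. If the kernel of \<open>U\<close> is shift invariant then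
  \<open>U (shift c)\<close> depends only on \<open>U c\<close>, so that \<open>U c \<mapsto> U (shift c)\<close> is an operator on the
  whole space, which extends \<open>T\<close> and has norm at most \<open>sqrt (B / A)\<close>. Conversely, a bounded
  \<open>T\<close> maps partial sums tending to \<open>0\<close> to partial sums tending to \<open>0\<close>.
  If \<open>\<parallel>T\<parallel> < 1\<close>, then \<open>f 0 = T\<^sup>n (f (- n))\<close> together with the boundedness of \<open>f\<close> gives \<open>f 0 = 0\<close>.
  All this is done for a shift by an arbitrary integer; \<open>T\<close> and its inverse are the cases
  \<open>1\<close> and \<open>- 1\<close>.
\<close>

section \<open>Complex inner products\<close>

lemma cinner_add_right: "cinner x (y + z) = cinner x y + cinner x z"
  by (metis cinner_add_left cinner_commute complex_cnj_add)

lemma cinner_scaleC_right: "cinner x (a *\<^sub>C y) = cnj a * cinner x y"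
  by (metis cinner_commute cinner_scaleC_left complex_cnj_mult)

lemma cinner_zero_left: "cinner 0 y = 0"
  using cinner_add_left[of 0 0 y] by simp

lemma cinner_sum_left: "cinner (sum g F) y = (\<Sum>k\<in>F. cinner (g k) y)"
  by (induction F rule: infinite_finite_induct) (auto simp: cinner_zero_left cinner_add_left)

lemma cinner_diff_left: "cinner (x - y) z = cinner x z - cinner y z"
  by (metis add_diff_cancel cinner_add_left diff_add_cancel)

lemma norm_power2_eq_cinner: "(norm x)\<^sup>2 = Re (cinner x x)"
  by (simp add: norm_eq_sqrt_cinner cinner_self_nonneg)

lemma cinner_self: "cinner x x = complex_of_real ((norm x)\<^sup>2)"
proof -
  have "Im (cinner x x) = 0"
    using arg_cong[OF cinner_commute[of x x], of Im] by simp
  then show ?thesis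
    by (simp add: complex_eq_iff norm_power2_eq_cinner)
qed

lemma norm_scaleC: "norm (a *\<^sub>C x) = cmod a * norm x"
proof -
  have "cinner (a *\<^sub>C x) (a *\<^sub>C x) = (a * cnj a) * cinner x x"
    by (simp only: cinner_scaleC_left cinner_scaleC_right mult_ac)
  also have "\<dots> = complex_of_real ((cmod a)\<^sup>2 * (norm x)\<^sup>2)"
    by (simp only: cinner_self complex_norm_square[symmetric] of_real_mult of_real_power)
  finally have "(norm (a *\<^sub>C x))\<^sup>2 = (cmod a * norm x)\<^sup>2"
    by (simp only: norm_power2_eq_cinner Re_complex_of_real power_mult_distrib)
  then show ?thesis
    by (rule power2_eq_imp_eq) simp_all
qed

lemma norm_add_power2:
  "(norm (x + y))\<^sup>2 = (norm x)\<^sup>2 + 2 * Re (cinner x y) + (norm y)\<^sup>2"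
proof -
  have "Re (cinner y x) = Re (cinner x y)"
    by (subst cinner_commute) simp
  then show ?thesis
    by (simp add: norm_power2_eq_cinner cinner_add_left cinner_add_right)
qed

lemma Re_cinner_le: "Re (cinner x y) \<le> norm x * norm y"
proof -
  have "(norm (x + y))\<^sup>2 \<le> (norm x + norm y)\<^sup>2"
    by (simp add: norm_triangle_ineq power_mono)
  then show ?thesis
    by (simp add: norm_add_power2 power2_sum)
qed

lemma cmod_cinner_le: "cmod (cinner x y) \<le> norm x * norm y"
proof (cases "cinner x y = 0")
  case False
  \<comment> \<open>A unimodular factor that rotates \<open>cinner x y\<close> onto its modulus, so
    that the bound on real parts applies to \<open>u *\<^sub>C x\<close>.\<close>
  define u where "u = cnj (cinner x y) / cmod (cinner x y)"
  have "cmod u = 1"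
    using False by (simp add: u_def norm_divide)
  moreover have "cinner (u *\<^sub>C x) y = cmod (cinner x y)"
    using False complex_norm_square[of "cinner x y"]
    by (simp add: u_def cinner_scaleC_left field_simps power2_eq_square)
  ultimately show ?thesis
    using Re_cinner_le[of "u *\<^sub>C x" y] by (simp add: norm_scaleC)
qed simp

lemma bounded_linear_cinner_left: "bounded_linear (\<lambda>x. cinner x y)"
  by (rule bounded_linear_intro[where K = "norm y"])
    (auto simp: cinner_add_left scaleR_scaleC cinner_scaleC_left cmod_cinner_le scaleR_conv_of_real)

lemma bounded_linear_scaleC: "bounded_linear (\<lambda>x::'a::complex_hilbert_space. a *\<^sub>C x)"
  by (rule bounded_linear_intro[where K = "cmod a"])
    (auto simp: scaleC_add_right scaleR_scaleC scaleC_scaleC norm_scaleC mult.commute)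

section \<open>Square-summable sequences and their shifts\<close>

text \<open>Cauchy criterion: the hypothesis, applied to differences \<open>F - F0\<close>,
  transfers the Cauchy property from the partial sums of \<open>h\<close> to those of
  \<open>g\<close>, and completeness supplies the limit.\<close>

lemma summable_on_if_norm_sum_power2_le:
  fixes g :: "'i \<Rightarrow> 'a::banach"
  assumes h: "h summable_on (UNIV :: 'i set)" and B: "0 < B"
    and le: "\<And>F. finite F \<Longrightarrow> (norm (sum g F))\<^sup>2 \<le> B * sum h F"
  shows "g summable_on UNIV"
proof -
  obtain L where L: "(sum h \<longlongrightarrow> L) (finite_subsets_at_top UNIV)"
    using h by (auto simp: summable_on_def has_sum_def)
  have "\<exists>P. eventually P (finite_subsets_at_top UNIV) \<and>
          (\<forall>F F'. P F \<and> P F' \<longrightarrow> dist (sum g F) (sum g F') < e)" if e: "e > 0" for e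
  proof -
    \<comment> \<open>Chosen so that \<open>B * (2 * d)\<close> equals
      \<open>(e / 2)\<^sup>2\<close>; two partial sums of \<open>h\<close> that are
      \<open>d\<close>-close to \<open>L\<close> differ by less than \<open>2 * d\<close>.\<close>
    define d where "d = e\<^sup>2 / (8 * B)"
    have "d > 0" using e B by (simp add: d_def)
    then have "\<forall>\<^sub>F F in finite_subsets_at_top UNIV. dist (sum h F) L < d"
      using L by (simp add: tendsto_iff)
    then obtain F0 where F0: "finite F0"
      and close: "\<And>F. finite F \<Longrightarrow> F0 \<subseteq> F \<Longrightarrow> dist (sum h F) L < d"
      by (auto simp: eventually_finite_subsets_at_top)
    have half: "dist (sum g F) (sum g F0) < e / 2" if F: "finite F" "F0 \<subseteq> F" for F
    proof -
      have "(norm (sum g F - sum g F0))\<^sup>2 \<le> B * (sum h F - sum h F0)"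
        using le[of "F - F0"] F by (simp add: sum_diff)
      also have "sum h F - sum h F0 < 2 * d"
        using close[OF F] close[OF F0 order_refl] by (simp add: dist_real_def)
      then have "B * (sum h F - sum h F0) < (e / 2)\<^sup>2"
        using B by (simp add: d_def power_divide field_simps)
      finally show ?thesis
        using e power2_less_imp_less[of _ "e / 2"] by (simp add: dist_norm)
    qed
    have "\<forall>\<^sub>F F in finite_subsets_at_top UNIV. finite F \<and> F0 \<subseteq> F"
      using F0 by (auto simp: eventually_finite_subsets_at_top)
    moreover have "dist (sum g F) (sum g F') < e"
      if "finite F \<and> F0 \<subseteq> F" "finite F' \<and> F0 \<subseteq> F'" for F F'
      using half[of F] half[of F'] that dist_triangle2[of "sum g F" "sum g F'" "sum g F0"] by simp
    ultimately show ?thesis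
      by blast
  qed
  then have "cauchy_filter (filtermap (sum g) (finite_subsets_at_top UNIV))"
    by (simp add: cauchy_filter_metric_filtermap)
  moreover have "complete (UNIV :: 'a set)"
    by (rule complete_UNIV)
  ultimately obtain L' where "(sum g \<longlongrightarrow> L') (finite_subsets_at_top UNIV)"
    using complete_uniform[where S = UNIV] by (force simp: filterlim_def)
  then show ?thesis
    by (auto simp: summable_on_def has_sum_def)
qed

lemma ell2_add:
  assumes "c \<in> ell2" "d \<in> ell2"
  shows "(\<lambda>k. c k + d k) \<in> ell2"
proof -
  have "(\<lambda>k. 2 * (cmod (c k))\<^sup>2 + 2 * (cmod (d k))\<^sup>2) summable_on UNIV"
    using assms unfolding ell2_def by (auto intro!: summable_on_add summable_on_cmult_right)
  moreover have "(cmod (c k + d k))\<^sup>2 \<le> 2 * (cmod (c k))\<^sup>2 + 2 * (cmod (d k))\<^sup>2" for k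
  proof -
    have "(cmod (c k + d k))\<^sup>2 \<le> (cmod (c k) + cmod (d k))\<^sup>2"
      by (simp add: norm_triangle_ineq power_mono)
    also have "\<dots> \<le> 2 * (cmod (c k))\<^sup>2 + 2 * (cmod (d k))\<^sup>2"
      using sum_squares_bound[of "cmod (c k)" "cmod (d k)"] by (simp add: power2_sum)
    finally show ?thesis .
  qed
  ultimately show ?thesis
    unfolding ell2_def by (auto intro: summable_on_comparison_test)
qed

lemma ell2_scale:
  assumes "c \<in> ell2"
  shows "(\<lambda>k. a * c k) \<in> ell2"
  using assms unfolding ell2_def
  by (auto simp: norm_mult power_mult_distrib intro!: summable_on_cmult_right)

lemma ell2_single: "(\<lambda>j. if j = k then a else 0) \<in> ell2"
  unfolding ell2_def mem_Collect_eq summable_on_def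
  by (rule exI, rule has_sum_finite_neutralI[where B = "{k}"]) auto

definition shift :: "int \<Rightarrow> (int \<Rightarrow> complex) \<Rightarrow> (int \<Rightarrow> complex)" where
  "shift s c = (\<lambda>k. c (k - s))"

lemma right_shift_eq: "right_shift = shift 1"
  by (auto simp: fun_eq_iff right_shift_def shift_def)

lemma left_shift_eq: "left_shift = shift (- 1)"
  by (auto simp: fun_eq_iff left_shift_def shift_def)

lemma shift_shift: "shift s (shift t c) = shift (s + t) c"
  by (simp add: shift_def algebra_simps)

lemma shift_0: "shift 0 c = c"
  by (simp add: shift_def)

lemma bij_betw_int_shift: "bij_betw (\<lambda>k. k - s) UNIV (UNIV :: int set)"
  by (rule bij_betwI[where g = "\<lambda>k. k + s"]) auto

lemma ell2_shift: "c \<in> ell2 \<Longrightarrow> shift s c \<in> ell2"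
  using summable_on_reindex_bij_betw[OF bij_betw_int_shift[of s], of "\<lambda>k. (cmod (c k))\<^sup>2"]
  by (simp add: ell2_def shift_def)

lemma infsum_shift: "(\<Sum>\<^sub>\<infinity>k. (cmod (shift s c k))\<^sup>2) = (\<Sum>\<^sub>\<infinity>k. (cmod (c k))\<^sup>2)"
  using infsum_reindex_bij_betw[OF bij_betw_int_shift[of s], of "\<lambda>k. (cmod (c k))\<^sup>2"]
  by (simp add: shift_def)

section \<open>The synthesis operator of a frame\<close>

locale frame_sequence =
  fixes f :: "int \<Rightarrow> 'a::complex_hilbert_space" and A B :: real
  assumes frame: "frame_with_bounds f A B"
begin

lemma A_pos: "0 < A" and B_pos: "0 < B"
  using frame by (auto simp: frame_with_bounds_def)

lemma coeffs_ell2: "(\<lambda>k. cinner x (f k)) \<in> ell2"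
  using frame by (auto simp: frame_with_bounds_def ell2_def)

lemma frame_lower: "A * (norm x)\<^sup>2 \<le> (\<Sum>\<^sub>\<infinity>k. (cmod (cinner x (f k)))\<^sup>2)"
  and frame_upper: "(\<Sum>\<^sub>\<infinity>k. (cmod (cinner x (f k)))\<^sup>2) \<le> B * (norm x)\<^sup>2"
  using frame by (auto simp: frame_with_bounds_def)

lemma sum_coeffs_le: "finite F \<Longrightarrow> (\<Sum>k\<in>F. (cmod (cinner x (f k)))\<^sup>2) \<le> B * (norm x)\<^sup>2"
  using finite_sum_le_infsum[of "\<lambda>k. (cmod (cinner x (f k)))\<^sup>2" UNIV F] coeffs_ell2[of x]
    frame_upper[of x] by (auto simp: ell2_def)

text \<open>The upper frame inequality is tested at \<open>f k\<close> itself and only the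
  \<open>k\<close>-th term is kept. The uniform bound serves later in the lower estimate for the
  operator norm.\<close>

lemma norm_element_le: "norm (f k) \<le> sqrt B"
proof -
  have "(norm (f k))\<^sup>2 * (norm (f k))\<^sup>2 \<le> B * (norm (f k))\<^sup>2"
    using sum_coeffs_le[of "{k}" "f k"] by (simp add: cinner_self norm_power flip: power2_eq_square)
  then have "(norm (f k))\<^sup>2 \<le> B"
    using B_pos by (cases "f k = 0") (simp_all only: mult_le_cancel_right, auto)
  then show ?thesis
    by (simp add: real_le_rsqrt)
qed

text \<open>Duality: pair the finite sum \<open>s\<close> with itself, apply Cauchy-Schwarz to the
  coefficients, bound the factor with \<open>cinner s (f k)\<close> by the upper frame inequality,
  and cancel one factor \<open>norm s\<close>.\<close>

lemma norm_finite_synthesis_le: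
  assumes "finite F"
  shows "(norm (\<Sum>k\<in>F. c k *\<^sub>C f k))\<^sup>2 \<le> B * (\<Sum>k\<in>F. (cmod (c k))\<^sup>2)"
proof -
  define s where "s = (\<Sum>k\<in>F. c k *\<^sub>C f k)"
  define q where "q = L2_set (\<lambda>k. cmod (c k)) F"
  have sym: "cmod (cinner (f k) s) = cmod (cinner s (f k))" for k
    by (metis cinner_commute complex_mod_cnj)
  have "(norm s)\<^sup>2 = cmod (cinner s s)"
    by (simp add: cinner_self norm_power)
  also have "cinner s s = (\<Sum>k\<in>F. c k * cinner (f k) s)"
    by (subst s_def) (simp add: cinner_sum_left cinner_scaleC_left)
  also have "cmod \<dots> \<le> (\<Sum>k\<in>F. \<bar>cmod (c k)\<bar> * \<bar>cmod (cinner s (f k))\<bar>)"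
    by (rule order_trans[OF norm_sum]) (simp add: norm_mult sym)
  also have "\<dots> \<le> q * L2_set (\<lambda>k. cmod (cinner s (f k))) F"
    unfolding q_def by (rule L2_set_mult_ineq)
  also have "\<dots> \<le> q * (sqrt B * norm s)"
  proof (rule mult_left_mono)
    have "L2_set (\<lambda>k. cmod (cinner s (f k))) F \<le> sqrt (B * (norm s)\<^sup>2)"
      unfolding L2_set_def using sum_coeffs_le[OF assms] by simp
    then show "L2_set (\<lambda>k. cmod (cinner s (f k))) F \<le> sqrt B * norm s"
      by (simp add: real_sqrt_mult)
  qed (simp add: q_def L2_set_nonneg)
  finally have "norm s * norm s \<le> q * sqrt B * norm s"
    by (simp add: power2_eq_square)
  then have "norm s \<le> q * sqrt B"
    using B_pos by (cases "s = 0") (auto simp: q_def L2_set_nonneg)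
  then have "(norm s)\<^sup>2 \<le> (q * sqrt B)\<^sup>2"
    by (simp add: power_mono)
  also have "\<dots> = B * (\<Sum>k\<in>F. (cmod (c k))\<^sup>2)"
    using B_pos by (simp add: q_def L2_set_def power_mult_distrib sum_nonneg)
  finally show ?thesis
    by (simp add: s_def)
qed

lemma synthesis_has_sum:
  assumes "c \<in> ell2"
  shows "((\<lambda>k. c k *\<^sub>C f k) has_sum synthesis f c) UNIV"
proof -
  have "(\<lambda>k. c k *\<^sub>C f k) summable_on UNIV"
  proof (rule summable_on_if_norm_sum_power2_le)
    show "(\<lambda>k. (cmod (c k))\<^sup>2) summable_on UNIV"
      using assms by (simp add: ell2_def)
  qed (fact B_pos, fact norm_finite_synthesis_le)
  then show ?thesis
    by (simp add: synthesis_def)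
qed

lemma synthesis_eqI: "((\<lambda>k. c k *\<^sub>C f k) has_sum x) UNIV \<Longrightarrow> synthesis f c = x"
  by (simp add: synthesis_def infsumI)

lemma synthesis_kernel_eq: "synthesis_kernel f = {c \<in> ell2. synthesis f c = 0}"
  using synthesis_has_sum by (auto simp: synthesis_kernel_def summable_on_def)

lemma norm_synthesis_le:
  assumes "c \<in> ell2"
  shows "(norm (synthesis f c))\<^sup>2 \<le> B * (\<Sum>\<^sub>\<infinity>k. (cmod (c k))\<^sup>2)"
proof (rule tendsto_upperbound)
  show "((\<lambda>F. (norm (\<Sum>k\<in>F. c k *\<^sub>C f k))\<^sup>2) \<longlongrightarrow> (norm (synthesis f c))\<^sup>2)
          (finite_subsets_at_top UNIV)"
    using synthesis_has_sum[OF assms] unfolding has_sum_def by (intro tendsto_intros)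
  have "(norm (\<Sum>k\<in>F. c k *\<^sub>C f k))\<^sup>2 \<le> B * (\<Sum>\<^sub>\<infinity>k. (cmod (c k))\<^sup>2)" if "finite F" for F
  proof -
    have "(\<Sum>k\<in>F. (cmod (c k))\<^sup>2) \<le> (\<Sum>\<^sub>\<infinity>k. (cmod (c k))\<^sup>2)"
      using assms that by (intro finite_sum_le_infsum) (auto simp: ell2_def)
    then show ?thesis
      using norm_finite_synthesis_le[OF that, of c] B_pos
      by (meson mult_left_mono order_trans less_imp_le)
  qed
  then show "\<forall>\<^sub>F F in finite_subsets_at_top UNIV.
      (norm (\<Sum>k\<in>F. c k *\<^sub>C f k))\<^sup>2 \<le> B * (\<Sum>\<^sub>\<infinity>k. (cmod (c k))\<^sup>2)"
    by (intro eventually_finite_subsets_at_top_weakI)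
qed simp

lemma synthesis_add:
  assumes "c \<in> ell2" "d \<in> ell2"
  shows "synthesis f (\<lambda>k. c k + d k) = synthesis f c + synthesis f d"
  using has_sum_add[OF assms[THEN synthesis_has_sum]]
  by (intro synthesis_eqI) (simp add: scaleC_add_left)

lemma synthesis_scale:
  assumes "c \<in> ell2"
  shows "synthesis f (\<lambda>k. a * c k) = a *\<^sub>C synthesis f c"
  using has_sum_bounded_linear[OF bounded_linear_scaleC synthesis_has_sum[OF assms], of a]
  by (intro synthesis_eqI) (simp add: scaleC_scaleC)

lemma synthesis_single: "synthesis f (\<lambda>j. if j = k then a else 0) = a *\<^sub>C f k"
  by (intro synthesis_eqI has_sum_finite_neutralI[where B = "{k}"]) auto

section \<open>The frame operator and surjectivity of synthesis\<close>

definition frame_operator :: "'a \<Rightarrow> 'a" where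
  "frame_operator x = synthesis f (\<lambda>k. cinner x (f k))"

lemma frame_operator_diff: "frame_operator (x - y) = frame_operator x - frame_operator y"
proof -
  have "frame_operator (x - y) + frame_operator y = frame_operator x"
    unfolding frame_operator_def synthesis_add[OF coeffs_ell2 coeffs_ell2, symmetric]
    by (simp add: cinner_diff_left)
  then show ?thesis
    by (simp add: algebra_simps)
qed

text \<open>Identifies the quadratic form of the frame operator with the quantity that the frame
  inequalities control.\<close>

lemma cinner_frame_operator:
  "cinner (frame_operator x) x = complex_of_real (\<Sum>\<^sub>\<infinity>k. (cmod (cinner x (f k)))\<^sup>2)"
proof -
  have "((\<lambda>k. cinner (cinner x (f k) *\<^sub>C f k) x) has_sum cinner (frame_operator x) x) UNIV"
    unfolding frame_operator_def
    by (rule has_sum_bounded_linear[OF bounded_linear_cinner_left synthesis_has_sum[OF coeffs_ell2]])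
  moreover have "cinner (cinner x (f k) *\<^sub>C f k) x = complex_of_real ((cmod (cinner x (f k)))\<^sup>2)" for k
    by (metis cinner_commute cinner_scaleC_left complex_norm_square)
  moreover have "((\<lambda>k. complex_of_real ((cmod (cinner x (f k)))\<^sup>2)) has_sum
      complex_of_real (\<Sum>\<^sub>\<infinity>k. (cmod (cinner x (f k)))\<^sup>2)) UNIV"
    using coeffs_ell2[of x] by (intro has_sum_of_real has_sum_infsum) (simp add: ell2_def)
  ultimately show ?thesis
    using has_sum_unique by force
qed

text \<open>
  Richardson iteration: since \<open>\<parallel>F u\<parallel>\<^sup>2 \<le> B \<langle>F u, u\<rangle>\<close> for the frame operator \<open>F\<close>, the map
  \<open>I - F / B\<close> contracts by the factor \<open>sqrt (1 - A / B)\<close>.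
\<close>

lemma frame_operator_contraction:
  "norm (u - (1 / B) *\<^sub>R frame_operator u) \<le> sqrt (max 0 (1 - A / B)) * norm u"
proof -
  let ?q = "\<Sum>\<^sub>\<infinity>k. (cmod (cinner u (f k)))\<^sup>2"
  let ?F = "frame_operator u"
  have "(norm ?F)\<^sup>2 \<le> B * ?q"
    unfolding frame_operator_def by (rule norm_synthesis_le[OF coeffs_ell2])
  then have F: "(norm ?F)\<^sup>2 / B\<^sup>2 \<le> ?q / B"
    using B_pos by (simp add: field_simps power2_eq_square)
  have Re: "Re (cinner u ?F) = ?q"
    by (subst cinner_commute) (simp add: cinner_frame_operator)
  define t where "t = complex_of_real (- (1 / B))"
  have "u - (1 / B) *\<^sub>R ?F = u + t *\<^sub>C ?F"
    by (simp only: t_def scaleR_scaleC[symmetric] scaleR_minus_left add_uminus_conv_diff)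
  moreover have "Re (cinner u (t *\<^sub>C ?F)) = - ?q / B"
    by (simp only: cinner_scaleC_right t_def complex_cnj_complex_of_real) (simp add: Re)
  moreover have "(norm (t *\<^sub>C ?F))\<^sup>2 = (norm ?F)\<^sup>2 / B\<^sup>2"
    by (simp add: norm_scaleC t_def norm_divide power_mult_distrib power_divide)
  ultimately have "(norm (u - (1 / B) *\<^sub>R ?F))\<^sup>2 = (norm u)\<^sup>2 - 2 * ?q / B + (norm ?F)\<^sup>2 / B\<^sup>2"
    by (simp only: norm_add_power2)
  also have "\<dots> \<le> (norm u)\<^sup>2 - ?q / B"
    using F by simp
  also have "\<dots> \<le> (1 - A / B) * (norm u)\<^sup>2"
    using frame_lower[of u] B_pos by (simp add: field_simps)
  also have "\<dots> \<le> max 0 (1 - A / B) * (norm u)\<^sup>2"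
    by (intro mult_right_mono) auto
  finally have "norm (u - (1 / B) *\<^sub>R ?F) \<le> sqrt (max 0 (1 - A / B) * (norm u)\<^sup>2)"
    by (rule real_le_rsqrt)
  then show ?thesis
    by (simp add: real_sqrt_mult)
qed

lemma frame_operator_surj: "\<exists>y. frame_operator y = x"
proof -
  \<comment> \<open>A fixed point of this map is exactly a preimage of \<open>x\<close>, and
    differences of its values are the contraction above applied to \<open>y - z\<close>.\<close>
  let ?g = "\<lambda>y. y + (1 / B) *\<^sub>R (x - frame_operator y)"
  have "\<exists>!y. ?g y = y"
  proof (rule banach_fix_type)
    \<comment> \<open>The frame inequalities force \<open>A \<le> B\<close> only on a nonzero space;
      \<open>max 0\<close> keeps the contraction constant nonnegative on the zero space too.\<close>
    show "sqrt (max 0 (1 - A / B)) < 1"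
      using A_pos B_pos by simp
    have "?g y - ?g z = (y - z) - (1 / B) *\<^sub>R frame_operator (y - z)" for y z
      by (simp add: frame_operator_diff algebra_simps)
    then show "\<forall>y z. dist (?g y) (?g z) \<le> sqrt (max 0 (1 - A / B)) * dist y z"
      using frame_operator_contraction by (simp only: dist_norm) blast
  qed simp
  then show ?thesis
    using B_pos by auto
qed

text \<open>Take the frame coefficients of a preimage \<open>y\<close> of \<open>x\<close> under the
  frame operator. Their energy is \<open>Re (cinner x y)\<close>, at most
  \<open>norm x * norm y\<close>, and the lower frame inequality then gives
  \<open>A * norm y \<le> norm x\<close>.\<close>

lemma synthesis_surj:
  obtains c where "c \<in> ell2" "synthesis f c = x"
    "A * (\<Sum>\<^sub>\<infinity>k. (cmod (c k))\<^sup>2) \<le> (norm x)\<^sup>2"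
proof -
  obtain y where y: "frame_operator y = x"
    using frame_operator_surj by blast
  let ?q = "\<Sum>\<^sub>\<infinity>k. (cmod (cinner y (f k)))\<^sup>2"
  have "?q = Re (cinner x y)"
    using cinner_frame_operator[of y] y by simp
  then have q: "?q \<le> norm x * norm y"
    by (simp add: Re_cinner_le)
  then have "A * norm y * norm y \<le> norm x * norm y"
    using frame_lower[of y] by (simp add: power2_eq_square)
  then have "A * norm y \<le> norm x"
    by (cases "y = 0") auto
  have "A * ?q \<le> A * (norm x * norm y)"
    using q A_pos by (intro mult_left_mono) auto
  also have "\<dots> = norm x * (A * norm y)"
    by (rule mult.left_commute)
  also have "\<dots> \<le> norm x * norm x"
    using \<open>A * norm y \<le> norm x\<close> by (rule mult_left_mono) simp
  finally have "A * ?q \<le> (norm x)\<^sup>2"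
    by (simp only: power2_eq_square)
  then show thesis
    using that[of "\<lambda>k. cinner y (f k)"] coeffs_ell2 y by (simp add: frame_operator_def)
qed

section \<open>Operators induced by shifts\<close>

text \<open>The chosen coefficients are irrelevant when the kernel of the synthesis operator is invariant.\<close>

definition shift_op :: "int \<Rightarrow> 'a \<Rightarrow> 'a" where
  "shift_op s x = synthesis f (shift s (SOME c. c \<in> ell2 \<and> synthesis f c = x))"

context
  fixes s :: int
  assumes inv: "shift s ` synthesis_kernel f \<subseteq> synthesis_kernel f"
begin

lemma shift_op_synthesis:
  assumes c: "c \<in> ell2"
  shows "shift_op s (synthesis f c) = synthesis f (shift s c)"
proof -
  define d where "d = (SOME d. d \<in> ell2 \<and> synthesis f d = synthesis f c)"
  have d: "d \<in> ell2" "synthesis f d = synthesis f c"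
    using someI[of "\<lambda>d. d \<in> ell2 \<and> synthesis f d = synthesis f c" c] c by (auto simp: d_def)
  \<comment> \<open>Two coefficient sequences of the same vector differ by a kernel element. The
    factor \<open>- 1\<close> puts the difference into the form of the rules for sums and
    multiples.\<close>
  define n where "n = (\<lambda>k. d k + (- 1) * c k)"
  have "n \<in> synthesis_kernel f"
    unfolding synthesis_kernel_eq n_def using c d
    by (simp only: mem_Collect_eq ell2_add ell2_scale synthesis_add synthesis_scale) simp
  then have "shift s n \<in> synthesis_kernel f"
    using inv by blast
  then have "synthesis f (\<lambda>k. shift s d k + (- 1) * shift s c k) = 0"
    by (simp add: synthesis_kernel_eq n_def shift_def)
  then have "synthesis f (shift s d) + (- 1) *\<^sub>C synthesis f (shift s c) = 0"
    using c d by (simp only: synthesis_add synthesis_scale ell2_shift ell2_scale)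
  then show ?thesis
    by (simp add: shift_op_def d_def)
qed

lemma shift_op_clinear: "clinear_on UNIV (shift_op s)"
proof -
  have "shift_op s (x + y) = shift_op s x + shift_op s y" for x y
  proof -
    obtain c d where c: "c \<in> ell2" "synthesis f c = x" and d: "d \<in> ell2" "synthesis f d = y"
      using synthesis_surj by metis
    have "shift_op s (x + y) = synthesis f (\<lambda>k. shift s c k + shift s d k)"
      using shift_op_synthesis[OF ell2_add[OF c(1) d(1)]] c d by (simp add: synthesis_add shift_def)
    then show ?thesis
      using c d shift_op_synthesis by (auto simp: synthesis_add ell2_shift)
  qed
  moreover have "shift_op s (a *\<^sub>C x) = a *\<^sub>C shift_op s x" for a x
  proof -
    obtain c where c: "c \<in> ell2" "synthesis f c = x"
      using synthesis_surj by metis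
    have "shift_op s (a *\<^sub>C x) = synthesis f (\<lambda>k. a * shift s c k)"
      using shift_op_synthesis[OF ell2_scale[OF c(1)], of a] c
      by (simp add: synthesis_scale shift_def)
    then show ?thesis
      using c shift_op_synthesis by (auto simp: synthesis_scale ell2_shift)
  qed
  ultimately show ?thesis
    by (simp add: clinear_on_def)
qed

text \<open>Since any coefficients of \<open>x\<close> may be used, the economical ones from
  \<open>synthesis_surj\<close> are taken: they cost a factor \<open>1 / A\<close>, shifting
  preserves their energy, and synthesis costs a factor \<open>B\<close>.\<close>

lemma norm_shift_op_le: "norm (shift_op s x) \<le> sqrt (B / A) * norm x"
proof -
  obtain c where c: "c \<in> ell2" "synthesis f c = x"
    and le: "A * (\<Sum>\<^sub>\<infinity>k. (cmod (c k))\<^sup>2) \<le> (norm x)\<^sup>2"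
    by (rule synthesis_surj)
  have "(norm (shift_op s x))\<^sup>2 \<le> B * (\<Sum>\<^sub>\<infinity>k. (cmod (c k))\<^sup>2)"
    using norm_synthesis_le[OF ell2_shift[OF c(1)], of s] shift_op_synthesis[OF c(1)] c(2)
    by (simp add: infsum_shift)
  also have "\<dots> \<le> B / A * (norm x)\<^sup>2"
    using mult_left_mono[OF le, of "B / A"] A_pos B_pos by simp
  finally have "norm (shift_op s x) \<le> sqrt (B / A * (norm x)\<^sup>2)"
    by (rule real_le_rsqrt)
  then show ?thesis
    by (simp only: real_sqrt_mult real_sqrt_abs abs_norm_cancel)
qed

end

lemma bij_shift_op:
  assumes "shift s ` synthesis_kernel f \<subseteq> synthesis_kernel f"
    and "shift (- s) ` synthesis_kernel f \<subseteq> synthesis_kernel f"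
  shows "bij (shift_op s)"
proof -
  \<comment> \<open>Stated for any opposite shifts \<open>t\<close> and \<open>r\<close>, so that
    both compositions of \<open>shift_op s\<close> and \<open>shift_op (- s)\<close> are
    instances.\<close>
  have inverse: "shift_op t (shift_op r x) = x"
    if "shift t ` synthesis_kernel f \<subseteq> synthesis_kernel f"
      "shift r ` synthesis_kernel f \<subseteq> synthesis_kernel f" "t + r = 0" for t r x
  proof -
    obtain c where "c \<in> ell2" "synthesis f c = x"
      by (rule synthesis_surj)
    then show ?thesis
      using shift_op_synthesis[OF that(2), of c] shift_op_synthesis[OF that(1), of "shift r c"] that(3)
      by (simp add: ell2_shift shift_shift shift_0)
  qed
  show ?thesis
    by (rule o_bij[where g = "shift_op (- s)"]) (use inverse assms in \<open>auto simp: fun_eq_iff\<close>)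
qed

section \<open>Operators on the span that shift the frame\<close>

context
  fixes s :: int and T :: "'a \<Rightarrow> 'a"
  assumes lin: "clinear_on (cspan (range f)) T"
    and T_shift: "\<And>k. T (f k) = f (k + s)"
begin

lemma T_add: "x \<in> cspan (range f) \<Longrightarrow> y \<in> cspan (range f) \<Longrightarrow> T (x + y) = T x + T y"
  and T_scale: "x \<in> cspan (range f) \<Longrightarrow> T (a *\<^sub>C x) = a *\<^sub>C T x"
  using lin by (auto simp: clinear_on_def)

lemma T_zero: "T 0 = 0"
  using T_scale[of 0 0] by (simp add: complex_vector.span_zero)

lemma f_in_span: "f k \<in> cspan (range f)"
  by (simp add: complex_vector.span_base)

lemma T_sum:
  "finite F \<Longrightarrow> T (\<Sum>k\<in>F. c k *\<^sub>C f k) = (\<Sum>k\<in>F. c k *\<^sub>C f (k + s))"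
  by (induction F rule: finite_induct)
    (simp_all add: T_zero T_add T_scale T_shift f_in_span
      complex_vector.span_sum complex_vector.span_scale)

text \<open>Links \<open>T\<close> to the shift: one sequence has to represent \<open>x\<close> and,
  once shifted, \<open>T x\<close>. It is built by induction over finite linear
  combinations.\<close>

lemma span_synthesis:
  assumes "x \<in> cspan (range f)"
  shows "\<exists>c\<in>ell2. synthesis f c = x \<and> synthesis f (shift s c) = T x"
proof -
  \<comment> \<open>Membership in the span is carried through the induction because \<open>T\<close>
    is additive only there.\<close>
  have "x \<in> cspan (range f) \<and> (\<exists>c\<in>ell2. synthesis f c = x \<and> synthesis f (shift s c) = T x)"
    using assms
  proof (induction rule: complex_vector.span_induct_alt)
    case base
    have "(\<lambda>k. 0) \<in> ell2" "synthesis f (\<lambda>k. 0) = 0"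
      by (simp_all add: ell2_def synthesis_def)
    then show ?case
      by (auto simp: complex_vector.span_zero T_zero shift_def intro!: bexI[of _ "\<lambda>k. 0"])
  next
    case (step a x y)
    then obtain k c where x: "x = f k" and y: "y \<in> cspan (range f)"
      and c: "c \<in> ell2" "synthesis f c = y" "synthesis f (shift s c) = T y"
      by auto
    let ?e = "\<lambda>j. if j = k then a else 0"
    let ?d = "\<lambda>j. ?e j + c j"
    have "shift s ?d = (\<lambda>j. (if j = k + s then a else 0) + shift s c j)"
      by (auto simp: shift_def fun_eq_iff)
    then have "synthesis f (shift s ?d) = a *\<^sub>C f (k + s) + T y"
      using c by (simp only: synthesis_add ell2_single ell2_shift synthesis_single)
    moreover have "synthesis f ?d = a *\<^sub>C x + y"
      using c x by (simp only: synthesis_add ell2_single synthesis_single)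
    moreover have "?d \<in> ell2"
      using c by (intro ell2_add ell2_single)
    moreover have "T (a *\<^sub>C x + y) = a *\<^sub>C f (k + s) + T y"
      using x y by (simp add: T_add T_scale T_shift f_in_span complex_vector.span_scale)
    ultimately show ?case
      using x y f_in_span
      by (auto simp: complex_vector.span_add complex_vector.span_scale intro!: bexI[of _ ?d])
  qed
  then show ?thesis ..
qed

lemma shift_op_eq:
  assumes "shift s ` synthesis_kernel f \<subseteq> synthesis_kernel f" and "x \<in> cspan (range f)"
  shows "shift_op s x = T x"
  using span_synthesis[OF assms(2)] shift_op_synthesis[OF assms(1)] by metis

lemma norm_T_le:
  assumes "shift s ` synthesis_kernel f \<subseteq> synthesis_kernel f" and "x \<in> cspan (range f)"
  shows "norm (T x) \<le> sqrt (B / A) * norm x"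
  using norm_shift_op_le[OF assms(1), of x] shift_op_eq[OF assms] by simp

lemma shift_invariant_if_bounded:
  assumes "bounded_operator_on (cspan (range f)) T"
  shows "shift s ` synthesis_kernel f \<subseteq> synthesis_kernel f"
proof -
  obtain K where K: "\<And>x. x \<in> cspan (range f) \<Longrightarrow> norm (T x) \<le> K * norm x"
    using assms by (auto simp: bounded_operator_on_def)
  have "shift s c \<in> synthesis_kernel f" if "c \<in> synthesis_kernel f" for c
  proof -
    have c: "c \<in> ell2" "synthesis f c = 0"
      using that by (auto simp: synthesis_kernel_eq)
    have "(sum (\<lambda>k. c k *\<^sub>C f k) \<longlongrightarrow> 0) (finite_subsets_at_top UNIV)"
      using synthesis_has_sum[OF c(1)] c(2) by (simp add: has_sum_def)
    then have lim: "((\<lambda>F. K * norm (\<Sum>k\<in>F. c k *\<^sub>C f k)) \<longlongrightarrow> 0) (finite_subsets_at_top UNIV)"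
      by (intro tendsto_mult_right_zero tendsto_norm_zero)
    \<comment> \<open>The bound on \<open>T\<close> is used only for finite partial sums, which lie
      in the span.\<close>
    have "norm (\<Sum>k\<in>F. c k *\<^sub>C f (k + s)) \<le> K * norm (\<Sum>k\<in>F. c k *\<^sub>C f k)"
      if "finite F" for F
      using K[of "\<Sum>k\<in>F. c k *\<^sub>C f k"] that
      by (simp add: T_sum complex_vector.span_sum complex_vector.span_scale f_in_span)
    then have "\<forall>\<^sub>F F in finite_subsets_at_top UNIV.
        norm (\<Sum>k\<in>F. c k *\<^sub>C f (k + s)) \<le> K * norm (\<Sum>k\<in>F. c k *\<^sub>C f k)"
      by (intro eventually_finite_subsets_at_top_weakI)
    then have "(sum (\<lambda>k. c k *\<^sub>C f (k + s)) \<longlongrightarrow> 0) (finite_subsets_at_top UNIV)"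
      using lim by (rule Lim_null_comparison)
    then have "((\<lambda>k. c k *\<^sub>C f (k + s)) has_sum 0) UNIV"
      by (simp add: has_sum_def)
    \<comment> \<open>Reindexing by \<open>k - s\<close> moves the shift from the frame elements to
      the coefficients.\<close>
    then have "((\<lambda>k. shift s c k *\<^sub>C f k) has_sum 0) UNIV"
      using has_sum_reindex_bij_betw[OF bij_betw_int_shift[of s], of "\<lambda>k. c k *\<^sub>C f (k + s)"]
      by (simp add: shift_def)
    then show ?thesis
      using c(1) by (auto simp: synthesis_kernel_eq ell2_shift synthesis_eqI)
  qed
  then show ?thesis
    by blast
qed

lemma bounded_iff_shift_invariant:
  "bounded_operator_on (cspan (range f)) T \<longleftrightarrow>
     shift s ` synthesis_kernel f \<subseteq> synthesis_kernel f"
  using shift_invariant_if_bounded norm_T_le unfolding bounded_operator_on_def by blast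

section \<open>Bounds for the operator norm\<close>

lemma onorm_on_le:
  assumes "bounded_operator_on (cspan (range f)) T"
  shows "onorm_on (cspan (range f)) T \<le> sqrt (B / A)"
  unfolding onorm_on_def
proof (rule cSUP_least)
  show "cspan (range f) \<noteq> {}"
    using f_in_span by blast
next
  fix x assume x: "x \<in> cspan (range f)"
  have "norm (T x) \<le> sqrt (B / A) * norm x"
    using shift_invariant_if_bounded[OF assms] x by (rule norm_T_le)
  then show "norm (T x) / norm x \<le> sqrt (B / A)"
    using A_pos B_pos by (cases "x = 0") (auto simp: field_simps)
qed

text \<open>On the zero space every quotient is \<open>0 / 0 = 0\<close> and so is the supremum;
  hence the assumption of a nonzero vector.\<close>

lemma onorm_on_ge:
  assumes bounded: "bounded_operator_on (cspan (range f)) T" and nonzero: "\<exists>x::'a. x \<noteq> 0"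
  shows "1 \<le> onorm_on (cspan (range f)) T"
proof (rule ccontr)
  define r where "r = onorm_on (cspan (range f)) T"
  assume "\<not> 1 \<le> onorm_on (cspan (range f)) T"
  then have "r < 1" by (simp add: r_def)
  obtain K where K: "\<And>x. x \<in> cspan (range f) \<Longrightarrow> norm (T x) \<le> K * norm x"
    using bounded by (auto simp: bounded_operator_on_def)
  have "norm (T x) / norm x \<le> \<bar>K\<bar>" if "x \<in> cspan (range f)" for x
  proof -
    have "norm (T x) \<le> \<bar>K\<bar> * norm x"
      by (rule order_trans[OF K[OF that]]) (simp add: mult_right_mono)
    then show ?thesis
      by (cases "x = 0") (auto simp: divide_le_eq)
  qed
  \<comment> \<open>The supremum of reals dominates the quotients only once they are known to be
    bounded above.\<close>
  then have "bdd_above ((\<lambda>x. norm (T x) / norm x) ` cspan (range f))"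
    by (auto simp: bdd_above_def)
  then have sup: "norm (T x) / norm x \<le> r" if "x \<in> cspan (range f)" for x
    unfolding r_def onorm_on_def using that by (rule cSUP_upper2[OF _ _ order_refl])
  have "0 \<le> r"
    using sup[OF complex_vector.span_zero] by simp
  have step: "norm (f (k + s)) \<le> r * norm (f k)" for k
    using sup[OF f_in_span[of k]] T_shift[of k] T_zero
    by (cases "f k = 0") (auto simp: divide_le_eq)
  have iterate: "norm (f (k + int n * s)) \<le> r ^ n * norm (f k)" for n k
  proof (induction n)
    case (Suc n)
    have "norm (f (k + int (Suc n) * s)) \<le> r * norm (f (k + int n * s))"
      using step[of "k + int n * s"] by (simp add: algebra_simps)
    also have "\<dots> \<le> r * (r ^ n * norm (f k))"
      using Suc \<open>0 \<le> r\<close> by (rule mult_left_mono)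
    finally show ?case
      by (simp add: mult.assoc)
  qed simp
  have "f j = 0" for j
  proof -
    \<comment> \<open>Start \<open>n\<close> steps back, at \<open>f (j - int n * s)\<close>, whose
      norm is at most \<open>sqrt B\<close> whatever \<open>n\<close> is.\<close>
    have "norm (f j) \<le> r ^ n * sqrt B" for n
      using iterate[of "j - int n * s" n] norm_element_le[of "j - int n * s"] \<open>0 \<le> r\<close>
      by (simp add: order_trans[OF _ mult_left_mono])
    moreover have "(\<lambda>n. r ^ n * sqrt B) \<longlonglongrightarrow> 0"
      using \<open>0 \<le> r\<close> \<open>r < 1\<close> by (intro tendsto_mult_left_zero LIMSEQ_realpow_zero)
    ultimately have "norm (f j) \<le> 0"
      by (intro LIMSEQ_le_const) auto
    then show ?thesis
      by simp
  qed
  moreover have "cinner x 0 = 0" for x :: 'a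
    by (subst cinner_commute) (simp add: cinner_zero_left)
  ultimately have "A * (norm x)\<^sup>2 \<le> 0" for x :: 'a
    using frame_lower[of x] by simp
  then show False
    using nonzero A_pos by (simp add: mult_le_0_iff)
qed

end

end

section \<open>Representations by powers of an operator\<close>

lemma represents_shift:
  assumes "represents T f"
  shows "T (f k) = f (k + 1)"
proof -
  let ?S = "cspan (range f)"
  have T: "bij_betw T ?S ?S" and f: "\<And>k. f k = int_funpow_on ?S T k (f 0)"
    using assms unfolding represents_def by blast+
  show ?thesis
  proof (cases "0 \<le> k")
    case True
    then show ?thesis
      by (subst (1 2) f) (simp add: int_funpow_on_def nat_add_distrib)
  next
    case False
    then have n: "nat (- k) = Suc (nat (- (k + 1)))"
      by simp
    have "f (k + 1) = (inv_into ?S T ^^ nat (- (k + 1))) (f 0)"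
      \<comment> \<open>For \<open>k = - 1\<close> the index \<open>k + 1\<close> is
        \<open>0\<close>, which falls under the nonnegative branch of \<open>int_funpow_on\<close>;
        both branches give the identity there.\<close>
      using False by (subst f) (cases "k + 1 = 0"; simp add: int_funpow_on_def)
    then have "f k = inv_into ?S T (f (k + 1))"
      using False n by (subst f) (simp add: int_funpow_on_def)
    moreover have "f (k + 1) \<in> T ` ?S"
      using T by (simp add: bij_betw_def complex_vector.span_base)
    ultimately show ?thesis
      by (simp add: f_inv_into_f)
  qed
qed

text \<open>The index is written \<open>k + - 1\<close> to match the shift pattern
  \<open>k + s\<close> with \<open>s = - 1\<close>.\<close>

lemma represents_inv_shift:
  assumes "represents T f"
  shows "inv_into (cspan (range f)) T (f k) = f (k + - 1)"
proof -
  have "inj_on T (cspan (range f))"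
    using assms unfolding represents_def bij_betw_def by blast
  moreover have "T (f (k - 1)) = f k"
    using represents_shift[OF assms, of "k - 1"] by simp
  ultimately show ?thesis
    using inv_into_f_f[of T "cspan (range f)" "f (k - 1)"] by (simp add: complex_vector.span_base)
qed

text \<open>By injectivity of \<open>T\<close> on the span, it suffices that both sides have the
  same image under \<open>T\<close>.\<close>

lemma represents_inv_clinear:
  assumes "represents T f"
  shows "clinear_on (cspan (range f)) (inv_into (cspan (range f)) T)"
proof -
  let ?S = "cspan (range f)" and ?I = "inv_into (cspan (range f)) T"
  have lin: "clinear_on ?S T" and bij: "bij_betw T ?S ?S"
    using assms unfolding represents_def by blast+
  have I: "?I x \<in> ?S" "T (?I x) = x" if "x \<in> ?S" for x
    using bij that by (auto simp: bij_betw_def inv_into_into f_inv_into_f)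
  have eqI: "?I x = y" if "y \<in> ?S" "T y = x" for x y
    using bij that by (auto simp: bij_betw_def)
  show ?thesis
    unfolding clinear_on_def
  proof (intro conjI ballI allI)
    fix x y assume "x \<in> ?S" "y \<in> ?S"
    then show "?I (x + y) = ?I x + ?I y"
      using I lin by (intro eqI) (auto simp: clinear_on_def complex_vector.span_add)
  next
    fix a x assume "x \<in> ?S"
    then show "?I (a *\<^sub>C x) = a *\<^sub>C ?I x"
      using I lin by (intro eqI) (auto simp: clinear_on_def complex_vector.span_scale)
  qed
qed

theorem theorem2p3:
  fixes f :: "int \<Rightarrow> 'a::complex_hilbert_space"
    and T :: "'a \<Rightarrow> 'a"
    and A B :: real
  assumes frame: "frame_with_bounds f A B"
    and repr: "represents T f"
  defines "S \<equiv> cspan (range f)"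
    and "N \<equiv> synthesis_kernel f"
  shows
    "(bounded_operator_on S T \<longleftrightarrow> right_shift_invariant N) \<and>
     (bounded_operator_on S T \<longrightarrow>
        ((\<exists>x::'a. x \<noteq> 0) \<longrightarrow> 1 \<le> onorm_on S T) \<and> onorm_on S T \<le> sqrt (B / A)) \<and>
     (bounded_operator_on S (inv_into S T) \<longleftrightarrow> left_shift_invariant N) \<and>
     (bounded_operator_on S (inv_into S T) \<longrightarrow>
        ((\<exists>x::'a. x \<noteq> 0) \<longrightarrow> 1 \<le> onorm_on S (inv_into S T)) \<and>
        onorm_on S (inv_into S T) \<le> sqrt (B / A)) \<and>
     (right_shift_invariant N \<and> left_shift_invariant N \<longrightarrow>
        (\<exists>T'. clinear_on UNIV T' \<and> bounded_operator_on UNIV T' \<and> bij T' \<and>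
              (\<forall>x\<in>S. T' x = T x)))"
proof -
  interpret frame_sequence f A B
    by unfold_locales (rule frame)
  have lin: "clinear_on S T"
    using repr unfolding represents_def S_def by blast
  \<comment> \<open>These two bundles instantiate the general results with shift \<open>1\<close>
    for \<open>T\<close> and shift \<open>- 1\<close> for its inverse.\<close>
  note T = lin[unfolded S_def] represents_shift[OF repr]
  note T_inv = represents_inv_clinear[OF repr] represents_inv_shift[OF repr]
  have right: "right_shift_invariant N \<longleftrightarrow> shift 1 ` N \<subseteq> N"
    by (simp add: right_shift_invariant_def right_shift_eq)
  have left: "left_shift_invariant N \<longleftrightarrow> shift (- 1) ` N \<subseteq> N"
    by (simp add: left_shift_invariant_def left_shift_eq)
  have "\<exists>T'. clinear_on UNIV T' \<and> bounded_operator_on UNIV T' \<and> bij T' \<and> (\<forall>x\<in>S. T' x = T x)"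
    if "shift 1 ` N \<subseteq> N" "shift (- 1) ` N \<subseteq> N"
    using that shift_op_clinear[of 1] norm_shift_op_le[of 1] bij_shift_op[of 1] shift_op_eq[OF T]
    unfolding bounded_operator_on_def N_def S_def by (intro exI[of _ "shift_op 1"]) blast
  then show ?thesis
    using bounded_iff_shift_invariant[OF T] onorm_on_le[OF T] onorm_on_ge[OF T]
      bounded_iff_shift_invariant[OF T_inv] onorm_on_le[OF T_inv] onorm_on_ge[OF T_inv]
    unfolding right left unfolding S_def N_def by blast
qed

end
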